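(* Let $(H,d)$ be a Hadamard space, let $(X_n)_{n\ge 1}$ be a sequence of independent random variables with $X_n\in\mathcal{L}^2(H)$ and expectations $\mathbb{E}(X_n)=\mu_n$, and let $\mu\in H$. For $n\ge 1$ put $$D_n=\max_{1\le k\le n}\max\bigl\{d(\mu,\mu_k),\ \mathbb{E}(d(X_k,\mu_k))\bigr\},$$ and let $S_n$ be the inductive mean of $X_1,\dots,X_n$. Then for every $n\ge 1$, $$\mathbb{E}\bigl(d(S_n,\mu)^2\bigr)\le \frac{6D_n}{n}\sum_{k=1}^n d(\mu_k,\mu)+\frac{1}{n^2}\sum_{k=1}^n\mathrm{Var}(X_k).$$
   Context: A Hadamard space is a complete metric space $(H,d)$ such that for all $x,y\in H$ there is $m\in H$ with $d(z,m)^2\le\frac12 d(z,x)^2+\frac12 d(z,y)^2-\frac14 d(x,y)^2$ for all $z\in H$. Any two points $x,y\in H$ are joined by a unique minimal geodesic, i.e. a map $\gamma:[0,1]\to H$ with $\gamma(0)=x$, $\gamma(1)=y$, $d(\gamma(s),\gamma(t))=|t-s|\,d(x,y)$; write $x\oplus_t y=\gamma(t)$. The inductive mean of $x_1,x_2,\dots$ is defined by $S_1=x_1$, $S_{n+1}=S_n\oplus_{\frac1{n+1}}x_{n+1}$ (applied pointwise to random variables). A random variable in $H$ is a Borel measurable map from a probability space to $H$; $X\in\mathcal{L}^p(H)$ ($p\ge1$) means $\mathbb{E}(d(X,z)^p)<\infty$ for some (equivalently all) $z\in H$. For $X\in\mathcal{L}^2(H)$, $\mathbb{E}(X)$ is the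 unique minimizer of $z\mapsto\mathbb{E}(d(X,z)^2)$ over $H$, and $\mathrm{Var}(X)=\mathbb{E}(d(X,\mathbb{E}(X))^2)$.
   Formalization: Each X_n is additionally assumed to take values almost surely in a separable closed set; this is automatic if H is separable or no real-valued measurable cardinal exists, and without it the claim fails in l^2(k) for a two-valued measurable cardinal k (X_n(i)=e_i). *)

theory Defs
  imports "HOL-Probability.Probability"
begin

class hadamard_space = complete_space +
  assumes midpoint_inequality:
    "\<exists>m. \<forall>z. (dist z m)\<^sup>2 \<le> 1/2 * (dist z x)\<^sup>2 + 1/2 * (dist z y)\<^sup>2 - 1/4 * (dist x y)\<^sup>2"

text \<open>Only the restriction of \<open>\<gamma>\<close> to the unit interval matters.\<close>

definition minimal_geodesic :: "(real \<Rightarrow> 'a::metric_space) \<Rightarrow> 'a \<Rightarrow> 'a \<Rightarrow> bool" where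
  "minimal_geodesic \<gamma> x y \<longleftrightarrow> \<gamma> 0 = x \<and> \<gamma> 1 = y \<and>
     (\<forall>s\<in>{0..1}. \<forall>t\<in>{0..1}. dist (\<gamma> s) (\<gamma> t) = \<bar>t - s\<bar> * dist x y)"

text \<open>\<open>geodesic_point x t y\<close> is $x \oplus_t y$, for \<open>t\<close> in the unit interval.\<close>

definition geodesic_point :: "'a::hadamard_space \<Rightarrow> real \<Rightarrow> 'a \<Rightarrow> 'a" where
  "geodesic_point x t y = (THE p. \<exists>\<gamma>. minimal_geodesic \<gamma> x y \<and> \<gamma> t = p)"

text \<open>Sequences are indexed from 1; the value at 0 is irrelevant.\<close>

fun inductive_mean :: "(nat \<Rightarrow> 'a::hadamard_space) \<Rightarrow> nat \<Rightarrow> 'a" where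
  "inductive_mean x 0 = undefined"
| "inductive_mean x (Suc 0) = x 1"
| "inductive_mean x (Suc (Suc n)) =
     geodesic_point (inductive_mean x (Suc n)) (1 / real (Suc (Suc n))) (x (Suc (Suc n)))"

definition square_integrable_rv :: "'b measure \<Rightarrow> ('b \<Rightarrow> 'a::metric_space) \<Rightarrow> bool" where
  "square_integrable_rv M X \<longleftrightarrow>
     X \<in> borel_measurable M \<and> (\<exists>z. integrable M (\<lambda>\<omega>. (dist (X \<omega>) z)\<^sup>2))"

text \<open>
  The law of \<open>X\<close> is concentrated on a separable closed set. This holds for every Borel random
  variable with values in a separable space, and for every Borel random variable whatsoever if
  there are no real-valued measurable cardinals. If \<open>\<kappa>\<close> is a two-valued measurable cardinal,
  a Borel map such as $i \mapsto e_i$ from \<open>\<kappa>\<close> into $\ell^2(\kappa)$ has a \<open>{0,1}\<close>-valued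
  law and is independent of itself, so laws of large numbers fail without such a condition.
\<close>

definition almost_separably_valued :: "'b measure \<Rightarrow> ('b \<Rightarrow> 'a::metric_space) \<Rightarrow> bool" where
  "almost_separably_valued M X \<longleftrightarrow> (\<exists>C. countable C \<and> (AE \<omega> in M. X \<omega> \<in> closure C))"

definition hexpectation :: "'b measure \<Rightarrow> ('b \<Rightarrow> 'a::hadamard_space) \<Rightarrow> 'a" where
  "hexpectation M X =
     (THE m. \<forall>z. (\<integral>\<omega>. (dist (X \<omega>) m)\<^sup>2 \<partial>M) \<le> (\<integral>\<omega>. (dist (X \<omega>) z)\<^sup>2 \<partial>M))"

definition hvariance :: "'b measure \<Rightarrow> ('b \<Rightarrow> 'a::hadamard_space) \<Rightarrow> real" where
  "hvariance M X = (\<integral>\<omega>. (dist (X \<omega>) (hexpectation M X))\<^sup>2 \<partial>M)"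

definition max_deviation ::
  "'b measure \<Rightarrow> (nat \<Rightarrow> 'b \<Rightarrow> 'a::metric_space) \<Rightarrow> (nat \<Rightarrow> 'a) \<Rightarrow> 'a \<Rightarrow> nat \<Rightarrow> real" where
  "max_deviation M X \<nu> \<mu> n =
     (MAX k\<in>{1..n}. max (dist \<mu> (\<nu> k)) (\<integral>\<omega>. dist (X k \<omega>) (\<nu> k) \<partial>M))"

end

theory Submission
  imports Defs
begin

text \<open>
  For a square integrable \<open>Y\<close> with expectation \<open>m\<close>, a Hadamard space has only one half of the identity
  known from Hilbert spaces, the variance inequality \<open>Var Y + d(m,z)\<^sup>2 \<le> E d(Y,z)\<^sup>2\<close> (lemma
  \<open>variance_inequality\<close>). That half suffices, because in the CAT(0) inequality for the geodesic
  point \<open>S\<^sub>n\<^sub>+\<^sub>1\<close> between \<open>S\<^sub>n\<close> and \<open>X\<^sub>n\<^sub>+\<^sub>1\<close> the mixed term \<open>d(S\<^sub>n,X\<^sub>n\<^sub>+\<^sub>1)\<^sup>2\<close> enters with a negative sign. By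
  independence its expectation is at least \<open>Var X\<^sub>n\<^sub>+\<^sub>1 + E d(S\<^sub>n,\<mu>\<^sub>n\<^sub>+\<^sub>1)\<^sup>2\<close> (lemma \<open>indep_sq_dist_ge\<close>). If
  all \<open>\<mu>\<^sub>n\<close> equal \<open>\<mu>\<close>, this gives \<open>(n+1)\<^sup>2 E d(S\<^sub>n\<^sub>+\<^sub>1,\<mu>)\<^sup>2 \<le> n\<^sup>2 E d(S\<^sub>n,\<mu>)\<^sup>2 + Var X\<^sub>n\<^sub>+\<^sub>1\<close>. In general, replacing
  \<open>\<mu>\<^sub>n\<^sub>+\<^sub>1\<close> by \<open>\<mu>\<close> costs terms with a factor \<open>d(\<mu>\<^sub>n\<^sub>+\<^sub>1,\<mu>)\<close> (lemma \<open>expected_sq_dist_geodesic_point\<close>), and the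
  remaining factors of these terms are controlled by \<open>D\<close>, because \<open>E d(S\<^sub>n,\<mu>) \<le> 2 D\<close> by convexity of the
  distance. Summing the recursion gives the theorem (lemma \<open>expected_sq_dist_inductive_mean\<close>).
  
  Geodesic points and expectations are both minimizers of functions that are strongly convex along
  midpoints. Lemma \<open>strongly_convex_minimizer\<close> yields existence, uniqueness and a quadratic growth
  bound at the minimizer; for a weighted sum of two squared distances this bound is the CAT(0)
  inequality, and for \<open>z \<mapsto> E d(Y,z)\<^sup>2\<close> it is the variance inequality.
  
  Since the space may be nonseparable, joint measurability of \<open>S\<^sub>n\<close> and \<open>X\<^sub>n\<^sub>+\<^sub>1\<close> is not automatic. The
  variables are therefore composed with Borel maps of separable range that fix a closed set carrying
  the law, which changes them only on null sets and keeps them independent.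
\<close>

section \<open>Minimizers of strongly convex functions\<close>

definition is_midpoint :: "'a::hadamard_space \<Rightarrow> 'a \<Rightarrow> 'a \<Rightarrow> bool" where
  "is_midpoint x y m \<longleftrightarrow>
     (\<forall>z. (dist z m)\<^sup>2 \<le> 1/2 * (dist z x)\<^sup>2 + 1/2 * (dist z y)\<^sup>2 - 1/4 * (dist x y)\<^sup>2)"

lemma is_midpoint_exists: "\<exists>m. is_midpoint x y m"
  unfolding is_midpoint_def by (rule midpoint_inequality)

lemma dist_is_midpoint:
  assumes "is_midpoint x y m"
  shows "dist x m = dist x y / 2"
proof -
  have "(dist x m)\<^sup>2 \<le> (dist x y / 2)\<^sup>2" "(dist y m)\<^sup>2 \<le> (dist x y / 2)\<^sup>2"
    using assms unfolding is_midpoint_def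
    by (auto simp: power_divide dist_commute dest: spec[of _ x] spec[of _ y])
  then have "dist x m \<le> dist x y / 2" "dist y m \<le> dist x y / 2"
    by (auto intro: power2_le_imp_le)
  then show ?thesis
    using dist_triangle[of x y m] by (simp add: dist_commute)
qed

text \<open>
  This one statement yields both geodesic points and expectations. A minimizing sequence is Cauchy
  because midpoints of two almost minimal points cannot beat the infimum. The minimizer \<open>p\<close> first
  satisfies the asserted inequality with constant \<open>0\<close> in front of \<open>(dist p z)\<^sup>2\<close>. If it holds with
  constant \<open>c\<close>, applying it to the midpoint of \<open>p\<close> and \<open>z\<close> gives it with constant \<open>(c + 1) / 2\<close>; in
  the limit the constant is \<open>1\<close>.
\<close>

lemma strongly_convex_minimizer:
  fixes \<phi> :: "'a::hadamard_space \<Rightarrow> real"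
  assumes cont: "continuous_on UNIV \<phi>"
    and nonneg: "\<And>z. 0 \<le> \<phi> z"
    and mid: "\<And>x y m. is_midpoint x y m \<Longrightarrow> \<phi> m \<le> 1/2 * \<phi> x + 1/2 * \<phi> y - 1/4 * (dist x y)\<^sup>2"
  shows "\<exists>p. \<forall>z. \<phi> p + (dist p z)\<^sup>2 \<le> \<phi> z"
proof -
  define I where "I = Inf (range \<phi>)"
  have bdd: "bdd_below (range \<phi>)"
    using nonneg by (auto intro!: bdd_belowI[of _ 0])
  have I_le: "I \<le> \<phi> z" for z
    unfolding I_def using bdd by (auto intro: cInf_lower)
  have "\<exists>u. \<phi> u < I + 1 / real (Suc n)" for n
    using cInf_lessD[of "range \<phi>" "I + 1 / real (Suc n)"] by (auto simp: I_def)
  then obtain u where u: "\<And>n. \<phi> (u n) < I + 1 / real (Suc n)"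
    by metis
  have close: "(dist (u n) (u k))\<^sup>2 \<le> 2 / real (Suc n) + 2 / real (Suc k)" for n k
  proof -
    obtain m where "is_midpoint (u n) (u k) m" using is_midpoint_exists by blast
    then show ?thesis
      using mid[of "u n" "u k" m] I_le[of m] u[of n] u[of k] by linarith
  qed
  have "Cauchy u"
  proof (rule metric_CauchyI)
    fix e :: real assume e: "0 < e"
    then obtain N where N: "1 / real (Suc N) < e\<^sup>2 / 4"
      using nat_approx_posE[of "e\<^sup>2 / 4"] by auto
    have "dist (u n) (u k) < e" if "N \<le> n" "N \<le> k" for n k
    proof -
      have "1 / real (Suc n) \<le> 1 / real (Suc N)" "1 / real (Suc k) \<le> 1 / real (Suc N)"
        using that by (auto intro!: divide_left_mono)
      then have "(dist (u n) (u k))\<^sup>2 < e\<^sup>2"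
        using close[of n k] N by linarith
      then show ?thesis using e by (meson less_imp_le power2_less_imp_less)
    qed
    then show "\<exists>N. \<forall>n\<ge>N. \<forall>k\<ge>N. dist (u n) (u k) < e" by blast
  qed
  then obtain p where p: "u \<longlonglongrightarrow> p"
    using Cauchy_convergent convergent_def by blast
  have "(\<lambda>n. \<phi> (u n)) \<longlonglongrightarrow> \<phi> p"
    using continuous_on_tendsto_compose[OF cont p] by simp
  moreover have "(\<lambda>n. I + 1 / real (Suc n)) \<longlonglongrightarrow> I + 0"
    by (intro tendsto_add tendsto_const LIMSEQ_Suc lim_1_over_n)
  ultimately have "\<phi> p \<le> I + 0"
    by (rule LIMSEQ_le) (use u less_imp_le in blast)
  then have min: "\<phi> p \<le> \<phi> z" for z
    using I_le[of z] by linarith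
  have improve: "\<phi> p + (1 - (1/2) ^ k) * (dist p z)\<^sup>2 \<le> \<phi> z" for k z
  proof (induction k arbitrary: z)
    case 0
    then show ?case using min by simp
  next
    case (Suc k)
    obtain m where m: "is_midpoint p z m" using is_midpoint_exists by blast
    have "\<phi> p + (1 - (1/2) ^ k) * (dist p m)\<^sup>2 \<le> \<phi> m"
      by (rule Suc)
    moreover have "(1 - (1/2) ^ Suc k) * (dist p z)\<^sup>2
        = 2 * ((1 - (1/2) ^ k) * (dist p m)\<^sup>2) + 1/2 * (dist p z)\<^sup>2"
      unfolding dist_is_midpoint[OF m] by (simp add: power_divide field_simps)
    ultimately show ?case
      using mid[OF m] by linarith
  qed
  have "\<phi> p + (dist p z)\<^sup>2 \<le> \<phi> z" for z
  proof (rule LIMSEQ_le_const2)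
    have "(\<lambda>k. \<phi> p + (1 - (1/2::real) ^ k) * (dist p z)\<^sup>2) \<longlonglongrightarrow> \<phi> p + (1 - 0) * (dist p z)\<^sup>2"
      by (intro tendsto_intros LIMSEQ_power_zero) auto
    then show "(\<lambda>k. \<phi> p + (1 - (1/2::real) ^ k) * (dist p z)\<^sup>2) \<longlonglongrightarrow> \<phi> p + (dist p z)\<^sup>2"
      by simp
  qed (use improve in auto)
  then show ?thesis by blast
qed

section \<open>Geodesic points and the CAT(0) inequality\<close>

lemma weighted_square_identity:
  fixes a b t :: real
  shows "(1 - t) * a\<^sup>2 + t * b\<^sup>2 = t * (1 - t) * (a + b)\<^sup>2 + ((1 - t) * a - t * b)\<^sup>2"
  by (simp add: power2_eq_square algebra_simps)

text \<open>
  The point is the minimizer \<open>p\<close> of \<open>\<lambda>z. (1 - t) * (dist z x)\<^sup>2 + t * (dist z y)\<^sup>2\<close>. Comparing \<open>p\<close> with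
  \<open>x\<close> and with \<open>y\<close> bounds the minimum from above by \<open>t * (1 - t) * (dist x y)\<^sup>2\<close>, while the triangle
  inequality gives the same bound from below. So the minimum has this value, and the inequality of
  the preceding minimization lemma becomes the CAT(0) inequality, which in turn fixes the distances
  of \<open>p\<close> from \<open>x\<close> and \<open>y\<close>.
\<close>

lemma division_point_exists:
  fixes x y :: "'a::hadamard_space"
  assumes t: "0 \<le> t" "t \<le> 1"
  shows "\<exists>p. dist x p = t * dist x y \<and> dist p y = (1 - t) * dist x y \<and>
    (\<forall>z. (dist z p)\<^sup>2 \<le> (1 - t) * (dist z x)\<^sup>2 + t * (dist z y)\<^sup>2 - t * (1 - t) * (dist x y)\<^sup>2)"
proof -
  define \<phi> where "\<phi> z = (1 - t) * (dist z x)\<^sup>2 + t * (dist z y)\<^sup>2" for z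
  let ?D = "dist x y"
  have mid: "\<phi> m \<le> 1/2 * \<phi> u + 1/2 * \<phi> v - 1/4 * (dist u v)\<^sup>2" if "is_midpoint u v m" for u v m
  proof -
    have "(dist m w)\<^sup>2 \<le> 1/2 * (dist u w)\<^sup>2 + 1/2 * (dist v w)\<^sup>2 - 1/4 * (dist u v)\<^sup>2" for w
      using that unfolding is_midpoint_def by (metis dist_commute)
    then have "\<phi> m \<le> (1 - t) * (1/2 * (dist u x)\<^sup>2 + 1/2 * (dist v x)\<^sup>2 - 1/4 * (dist u v)\<^sup>2)
        + t * (1/2 * (dist u y)\<^sup>2 + 1/2 * (dist v y)\<^sup>2 - 1/4 * (dist u v)\<^sup>2)"
      unfolding \<phi>_def using t by (intro add_mono mult_left_mono) auto
    also have "\<dots> = 1/2 * \<phi> u + 1/2 * \<phi> v - 1/4 * (dist u v)\<^sup>2"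
      unfolding \<phi>_def by (simp add: field_simps)
    finally show ?thesis .
  qed
  have "\<exists>p. \<forall>z. \<phi> p + (dist p z)\<^sup>2 \<le> \<phi> z"
  proof (rule strongly_convex_minimizer)
    show "continuous_on UNIV \<phi>" unfolding \<phi>_def by (intro continuous_intros)
    show "0 \<le> \<phi> z" for z using t by (simp add: \<phi>_def)
  qed (rule mid)
  then obtain p where p: "\<And>z. \<phi> p + (dist p z)\<^sup>2 \<le> \<phi> z" by blast
  let ?a = "dist p x" and ?b = "dist p y"
  \<comment> \<open>Weighted with \<open>1 - t\<close> and \<open>t\<close>, the comparisons with \<open>x\<close> and \<open>y\<close> add up to \<open>2 * \<phi> p\<close> on the left.\<close>
  have "(1 - t) * (\<phi> p + ?a\<^sup>2) \<le> (1 - t) * (t * ?D\<^sup>2)"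
    using mult_left_mono[OF p[of x], of "1 - t"] t by (simp add: \<phi>_def)
  moreover have "t * (\<phi> p + ?b\<^sup>2) \<le> t * ((1 - t) * ?D\<^sup>2)"
    using mult_left_mono[OF p[of y], of t] t by (simp add: \<phi>_def dist_commute)
  ultimately have upper: "\<phi> p \<le> t * (1 - t) * ?D\<^sup>2"
    by (simp add: \<phi>_def algebra_simps)
  have tri: "?D \<le> ?a + ?b"
    by (metis dist_commute dist_triangle)
  then have "t * (1 - t) * ?D\<^sup>2 \<le> t * (1 - t) * (?a + ?b)\<^sup>2"
    using t by (intro mult_left_mono power_mono) auto
  moreover have "\<phi> p = t * (1 - t) * (?a + ?b)\<^sup>2 + ((1 - t) * ?a - t * ?b)\<^sup>2"
    unfolding \<phi>_def by (rule weighted_square_identity)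
  ultimately have eq: "\<phi> p = t * (1 - t) * ?D\<^sup>2"
    using upper zero_le_power2[of "(1 - t) * ?a - t * ?b"] by linarith
  have cat: "(dist z p)\<^sup>2 \<le> (1 - t) * (dist z x)\<^sup>2 + t * (dist z y)\<^sup>2 - t * (1 - t) * ?D\<^sup>2" for z
    using p[of z] eq by (simp add: \<phi>_def dist_commute)
  have "?a\<^sup>2 \<le> (t * ?D)\<^sup>2"
    using cat[of x] by (simp add: dist_commute power2_eq_square algebra_simps)
  then have a: "?a \<le> t * ?D" by (rule power2_le_imp_le) (use t in simp)
  have "?b\<^sup>2 \<le> ((1 - t) * ?D)\<^sup>2"
    using cat[of y] by (simp add: dist_commute power2_eq_square algebra_simps)
  then have b: "?b \<le> (1 - t) * ?D" by (rule power2_le_imp_le) (use t in simp)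
  have "?a = t * ?D" "?b = (1 - t) * ?D"
    using a b tri by (auto simp: algebra_simps)
  then show ?thesis
    using cat by (auto simp: dist_commute intro!: exI[of _ p])
qed

text \<open>
  Division points for different parameters fit together to a minimal geodesic: the CAT(0)
  inequality at \<open>p s\<close>, tested with \<open>p r\<close>, has right-hand side \<open>((s - r) * dist x y)\<^sup>2\<close>. Tested with the
  point at parameter \<open>t\<close> of any other minimal geodesic, it has right-hand side \<open>0\<close>, which gives
  uniqueness. So the definite description in the definition of \<^const>\<open>geodesic_point\<close> is satisfied
  by the division point.
\<close>

lemma geodesic_point_cat0:
  fixes x y :: "'a::hadamard_space"
  assumes t: "0 \<le> t" "t \<le> 1"
  shows "dist x (geodesic_point x t y) = t * dist x y"
    and "dist (geodesic_point x t y) y = (1 - t) * dist x y"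
    and "(dist z (geodesic_point x t y))\<^sup>2
      \<le> (1 - t) * (dist z x)\<^sup>2 + t * (dist z y)\<^sup>2 - t * (1 - t) * (dist x y)\<^sup>2"
proof -
  let ?D = "dist x y"
  have "\<forall>s\<in>{0..1}. \<exists>p. dist x p = s * ?D \<and> dist p y = (1 - s) * ?D \<and>
    (\<forall>z. (dist z p)\<^sup>2 \<le> (1 - s) * (dist z x)\<^sup>2 + s * (dist z y)\<^sup>2 - s * (1 - s) * ?D\<^sup>2)"
    using division_point_exists[of _ x y] by simp
  from bchoice[OF this] obtain p where p:
      "\<And>s. s \<in> {0..1} \<Longrightarrow> dist x (p s) = s * ?D"
      "\<And>s. s \<in> {0..1} \<Longrightarrow> dist (p s) y = (1 - s) * ?D"
      "\<And>s z. s \<in> {0..1} \<Longrightarrow>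
         (dist z (p s))\<^sup>2 \<le> (1 - s) * (dist z x)\<^sup>2 + s * (dist z y)\<^sup>2 - s * (1 - s) * ?D\<^sup>2"
    by blast
  have ge: "dist (p r) (p s) = (s - r) * ?D" if "r \<in> {0..1}" "s \<in> {0..1}" "r \<le> s" for r s
  proof (rule antisym)
    have "(dist (p r) (p s))\<^sup>2 \<le> (1 - s) * (r * ?D)\<^sup>2 + s * ((1 - r) * ?D)\<^sup>2 - s * (1 - s) * ?D\<^sup>2"
      using p(3)[OF that(2), of "p r"] p(1)[OF that(1)] p(2)[OF that(1)] by (simp add: dist_commute)
    also have "\<dots> = ((s - r) * ?D)\<^sup>2"
      by (simp add: power2_eq_square algebra_simps)
    finally show "dist (p r) (p s) \<le> (s - r) * ?D"
      by (rule power2_le_imp_le) (use that in simp)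
    show "(s - r) * ?D \<le> dist (p r) (p s)"
      using dist_triangle[of x "p s" "p r"] p(1) that by (simp add: algebra_simps)
  qed
  have geo: "minimal_geodesic p x y"
    unfolding minimal_geodesic_def
  proof (intro conjI ballI)
    show "p 0 = x" using p(1)[of 0] by simp
    show "p 1 = y" using p(2)[of 1] by simp
    fix r s :: real assume "r \<in> {0..1}" "s \<in> {0..1}"
    then show "dist (p r) (p s) = \<bar>s - r\<bar> * ?D"
      using ge[of r s] ge[of s r] by (cases "r \<le> s") (auto simp: dist_commute)
  qed
  have uniq: "\<gamma> t = p t" if g: "minimal_geodesic \<gamma> x y" for \<gamma>
  proof -
    have ends: "\<gamma> 0 = x" "\<gamma> 1 = y"
      and iso: "dist (\<gamma> r) (\<gamma> s) = \<bar>s - r\<bar> * ?D" if "r \<in> {0..1}" "s \<in> {0..1}" for r s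
      using g that unfolding minimal_geodesic_def by blast+
    have "dist (\<gamma> t) x = t * ?D" "dist (\<gamma> t) y = (1 - t) * ?D"
      using iso[of t 0] iso[of t 1] ends t by simp_all
    then have "(dist (\<gamma> t) (p t))\<^sup>2 \<le> (1 - t) * (t * ?D)\<^sup>2 + t * ((1 - t) * ?D)\<^sup>2 - t * (1 - t) * ?D\<^sup>2"
      using p(3)[of t "\<gamma> t"] t by simp
    also have "\<dots> = 0"
      by (simp add: power2_eq_square algebra_simps)
    finally have "(dist (\<gamma> t) (p t))\<^sup>2 \<le> 0" .
    then show ?thesis by simp
  qed
  have "geodesic_point x t y = p t"
    unfolding geodesic_point_def
  proof (rule the_equality)
    show "\<exists>\<gamma>. minimal_geodesic \<gamma> x y \<and> \<gamma> t = p t" using geo by blast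
  qed (use uniq in blast)
  then show "dist x (geodesic_point x t y) = t * ?D"
    "dist (geodesic_point x t y) y = (1 - t) * ?D"
    "(dist z (geodesic_point x t y))\<^sup>2
      \<le> (1 - t) * (dist z x)\<^sup>2 + t * (dist z y)\<^sup>2 - t * (1 - t) * ?D\<^sup>2"
    using p[of t] t by simp_all
qed

text \<open>
  Since \<open>dist x y\<close> is at least \<open>\<bar>dist z x - dist z y\<bar>\<close>, the right-hand side of the CAT(0) inequality is at
  most the square of the convex combination.
\<close>

lemma dist_geodesic_point_convex:
  fixes x y z :: "'a::hadamard_space"
  assumes t: "0 \<le> t" "t \<le> 1"
  shows "dist z (geodesic_point x t y) \<le> (1 - t) * dist z x + t * dist z y"
proof (rule power2_le_imp_le)
  have "\<bar>dist z x - dist z y\<bar> \<le> dist x y"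
    by (metis abs_dist_diff_le dist_commute)
  then have "(dist z x - dist z y)\<^sup>2 \<le> (dist x y)\<^sup>2"
    by (metis abs_ge_zero power2_abs power_mono)
  then have "t * (1 - t) * (dist z x - dist z y)\<^sup>2 \<le> t * (1 - t) * (dist x y)\<^sup>2"
    using t by (intro mult_left_mono) auto
  moreover have "(1 - t) * (dist z x)\<^sup>2 + t * (dist z y)\<^sup>2 - t * (1 - t) * (dist z x - dist z y)\<^sup>2
      = ((1 - t) * dist z x + t * dist z y)\<^sup>2"
    by (simp add: power2_eq_square algebra_simps)
  ultimately show "(dist z (geodesic_point x t y))\<^sup>2 \<le> ((1 - t) * dist z x + t * dist z y)\<^sup>2"
    using geodesic_point_cat0(3)[OF t, of z x y] by linarith
qed (use t in simp)

text \<open>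
  For endpoints \<open>x'\<close>, \<open>y'\<close> near \<open>x\<close>, \<open>y\<close>, the point of \<open>x'\<close> and \<open>y'\<close> has distances to \<open>x\<close> and \<open>y\<close> near
  \<open>t * dist x y\<close> and \<open>(1 - t) * dist x y\<close>, and the CAT(0) inequality forces such points to be near the
  point of \<open>x\<close> and \<open>y\<close>. Continuity is what makes the inductive mean measurable.
\<close>

lemma continuous_on_geodesic_point:
  assumes t: "0 \<le> t" "t \<le> 1"
  shows "continuous_on UNIV (\<lambda>(x::'a::hadamard_space, y). geodesic_point x t y)"
  unfolding continuous_on_def
proof
  fix q :: "'a \<times> 'a"
  obtain x y where q: "q = (x, y)" by (rule prod.exhaust)
  let ?p = "geodesic_point x t y" and ?D = "dist x y"
  let ?g = "\<lambda>q'::'a \<times> 'a. geodesic_point (fst q') t (snd q')"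
  let ?A = "\<lambda>q'::'a \<times> 'a. dist x (fst q') + t * dist (fst q') (snd q')"
  let ?B = "\<lambda>q'::'a \<times> 'a. dist y (snd q') + (1 - t) * dist (fst q') (snd q')"
  let ?R = "\<lambda>q'. (1 - t) * (?A q')\<^sup>2 + t * (?B q')\<^sup>2 - t * (1 - t) * ?D\<^sup>2"
  have bound: "(dist (?g q') ?p)\<^sup>2 \<le> ?R q'" for q'
  proof -
    have "dist (?g q') x \<le> ?A q'"
      using dist_triangle[of x "?g q'" "fst q'"] geodesic_point_cat0(1)[OF t, of "fst q'" "snd q'"]
      by (simp add: dist_commute)
    moreover have "dist (?g q') y \<le> ?B q'"
      using dist_triangle[of y "?g q'" "snd q'"] geodesic_point_cat0(2)[OF t, of "fst q'" "snd q'"]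
      by (simp add: dist_commute)
    ultimately have "(1 - t) * (dist (?g q') x)\<^sup>2 \<le> (1 - t) * (?A q')\<^sup>2"
      "t * (dist (?g q') y)\<^sup>2 \<le> t * (?B q')\<^sup>2"
      using t by (auto intro!: mult_left_mono power_mono)
    then show ?thesis
      using geodesic_point_cat0(3)[OF t, of "?g q'" x y] by linarith
  qed
  have "(?R \<longlongrightarrow> (1 - t) * (dist x x + t * dist x y)\<^sup>2 + t * (dist y y + (1 - t) * dist x y)\<^sup>2
      - t * (1 - t) * ?D\<^sup>2) (at q)"
    unfolding q by (rule tendsto_eq_intros refl | simp)+
  moreover have "(1 - t) * (dist x x + t * dist x y)\<^sup>2 + t * (dist y y + (1 - t) * dist x y)\<^sup>2
      - t * (1 - t) * ?D\<^sup>2 = 0"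
    by (simp add: power2_eq_square algebra_simps)
  ultimately have "(?R \<longlongrightarrow> 0) (at q)" by simp
  then have "((\<lambda>q'. (dist (?g q') ?p)\<^sup>2) \<longlongrightarrow> 0) (at q)"
    by (rule tendsto_sandwich[rotated -1, where f = "\<lambda>_. 0"]) (auto simp: bound)
  then have "((\<lambda>q'. sqrt ((dist (?g q') ?p)\<^sup>2)) \<longlongrightarrow> sqrt 0) (at q)"
    by (rule tendsto_real_sqrt)
  then show "((\<lambda>(x, y). geodesic_point x t y) \<longlongrightarrow> (\<lambda>(x, y). geodesic_point x t y) q) (at q within UNIV)"
    by (subst tendsto_dist_iff) (simp add: q case_prod_unfold)
qed

section \<open>Expectation and variance inequality\<close>

lemma dist_square_le:
  fixes x y z :: "'a::metric_space"
  shows "(dist x z)\<^sup>2 \<le> 2 * (dist x y)\<^sup>2 + 2 * (dist y z)\<^sup>2"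
proof -
  have "(dist x z)\<^sup>2 \<le> (dist x y + dist y z)\<^sup>2"
    by (intro power_mono dist_triangle) simp
  then show ?thesis
    using sum_squares_bound[of "dist x y" "dist y z"] by (simp add: power2_sum)
qed

lemma borel_measurable_dist_const [measurable (raw)]:
  fixes X :: "'b \<Rightarrow> 'a::metric_space"
  assumes [measurable]: "X \<in> borel_measurable M"
  shows "(\<lambda>\<omega>. dist (X \<omega>) z) \<in> borel_measurable M"
  by (rule borel_measurable_continuous_on[of "\<lambda>x. dist x z"]) (auto intro!: continuous_intros assms)

context prob_space
begin

lemma square_integrable_rvD:
  assumes "square_integrable_rv M X"
  shows "X \<in> borel_measurable M" "integrable M (\<lambda>\<omega>. (dist (X \<omega>) z)\<^sup>2)"
    "integrable M (\<lambda>\<omega>. dist (X \<omega>) z)"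
proof -
  obtain w where X [measurable]: "X \<in> borel_measurable M" and w: "integrable M (\<lambda>\<omega>. (dist (X \<omega>) w)\<^sup>2)"
    using assms unfolding square_integrable_rv_def by blast
  show "X \<in> borel_measurable M" by fact
  show sq: "integrable M (\<lambda>\<omega>. (dist (X \<omega>) z)\<^sup>2)"
  proof (rule Bochner_Integration.integrable_bound)
    show "integrable M (\<lambda>\<omega>. 2 * (dist (X \<omega>) w)\<^sup>2 + 2 * (dist w z)\<^sup>2)"
      using w by simp
  qed (auto intro!: AE_I2 dist_square_le)
  then show "integrable M (\<lambda>\<omega>. dist (X \<omega>) z)"
    by (rule square_integrable_imp_integrable[rotated]) measurable
qed

lemma expectation_sq_dist_minimizer:
  fixes X :: "'a \<Rightarrow> 'c::hadamard_space"
  assumes X: "square_integrable_rv M X"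
  shows "\<exists>p. \<forall>z. (\<integral>\<omega>. (dist (X \<omega>) p)\<^sup>2 \<partial>M) + (dist p z)\<^sup>2 \<le> (\<integral>\<omega>. (dist (X \<omega>) z)\<^sup>2 \<partial>M)"
proof (rule strongly_convex_minimizer)
  note int [simp] = square_integrable_rvD(2,3)[OF X]
  let ?f = "\<lambda>z. \<integral>\<omega>. (dist (X \<omega>) z)\<^sup>2 \<partial>M"
  show "0 \<le> ?f z" for z by simp
  show "?f m \<le> 1/2 * ?f x + 1/2 * ?f y - 1/4 * (dist x y)\<^sup>2" if "is_midpoint x y m" for x y m
  proof -
    have "?f m \<le> (\<integral>\<omega>. 1/2 * (dist (X \<omega>) x)\<^sup>2 + 1/2 * (dist (X \<omega>) y)\<^sup>2 - 1/4 * (dist x y)\<^sup>2 \<partial>M)"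
      by (rule integral_mono) (use that in \<open>auto simp: is_midpoint_def\<close>)
    also have "\<dots> = 1/2 * ?f x + 1/2 * ?f y - 1/4 * (dist x y)\<^sup>2"
      by (simp add: prob_space)
    finally show ?thesis .
  qed
  show "continuous_on UNIV ?f"
    unfolding continuous_on_def
  proof
    fix w
    let ?c = "\<integral>\<omega>. dist (X \<omega>) w \<partial>M"
    have bound: "norm (?f z - ?f w) \<le> dist z w * (2 * ?c + dist z w)" for z
    proof -
      have "\<bar>?f z - ?f w\<bar> = \<bar>\<integral>\<omega>. (dist (X \<omega>) z)\<^sup>2 - (dist (X \<omega>) w)\<^sup>2 \<partial>M\<bar>"
        by simp
      also have "\<dots> \<le> (\<integral>\<omega>. \<bar>(dist (X \<omega>) z)\<^sup>2 - (dist (X \<omega>) w)\<^sup>2\<bar> \<partial>M)"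
        by (rule integral_abs_bound)
      also have "\<dots> \<le> (\<integral>\<omega>. dist z w * (2 * dist (X \<omega>) w + dist z w) \<partial>M)"
      proof (rule integral_mono)
        fix \<omega>
        have "\<bar>dist (X \<omega>) z - dist (X \<omega>) w\<bar> \<le> dist z w"
          by (metis abs_dist_diff_le dist_commute)
        then have "\<bar>dist (X \<omega>) z - dist (X \<omega>) w\<bar> * (dist (X \<omega>) z + dist (X \<omega>) w)
            \<le> dist z w * (2 * dist (X \<omega>) w + dist z w)"
          by (intro mult_mono) auto
        moreover have "(dist (X \<omega>) z)\<^sup>2 - (dist (X \<omega>) w)\<^sup>2
            = (dist (X \<omega>) z - dist (X \<omega>) w) * (dist (X \<omega>) z + dist (X \<omega>) w)"
          by (simp add: power2_eq_square algebra_simps)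
        ultimately show "\<bar>(dist (X \<omega>) z)\<^sup>2 - (dist (X \<omega>) w)\<^sup>2\<bar> \<le> dist z w * (2 * dist (X \<omega>) w + dist z w)"
          by (simp add: abs_mult)
      qed auto
      also have "\<dots> = dist z w * (2 * ?c + dist z w)"
        by (simp add: prob_space)
      finally show ?thesis by simp
    qed
    have "((\<lambda>z. dist z w * (2 * ?c + dist z w)) \<longlongrightarrow> dist w w * (2 * ?c + dist w w)) (at w)"
      by (intro tendsto_intros)
    then have "((\<lambda>z. dist z w * (2 * ?c + dist z w)) \<longlongrightarrow> 0) (at w)" by simp
    then have "((\<lambda>z. ?f z - ?f w) \<longlongrightarrow> 0) (at w)"
      by (rule Lim_null_comparison[rotated]) (use bound in auto)
    then show "(?f \<longlongrightarrow> ?f w) (at w within UNIV)"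
      by (simp add: LIM_zero_cancel)
  qed
qed

text \<open>
  The minimization lemma applies to \<open>z \<mapsto> \<integral>\<omega>. (dist (X \<omega>) z)\<^sup>2 \<partial>M\<close>, since the midpoint inequality
  survives integration. It shows that the expectation exists and is unique, and at the same time
  gives the lower bound below, which replaces the identity \<open>E \<bar>X - z\<bar>\<^sup>2 = Var X + \<bar>E X - z\<bar>\<^sup>2\<close> of
  Hilbert spaces.
\<close>

lemma variance_inequality:
  fixes X :: "'a \<Rightarrow> 'c::hadamard_space"
  assumes X: "square_integrable_rv M X"
  shows "hvariance M X + (dist (hexpectation M X) z)\<^sup>2 \<le> (\<integral>\<omega>. (dist (X \<omega>) z)\<^sup>2 \<partial>M)"
proof -
  obtain p where p: "\<And>z. (\<integral>\<omega>. (dist (X \<omega>) p)\<^sup>2 \<partial>M) + (dist p z)\<^sup>2 \<le> (\<integral>\<omega>. (dist (X \<omega>) z)\<^sup>2 \<partial>M)"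
    using expectation_sq_dist_minimizer[OF X] by blast
  have "hexpectation M X = p"
    unfolding hexpectation_def
  proof (rule the_equality)
    show "\<forall>z. (\<integral>\<omega>. (dist (X \<omega>) p)\<^sup>2 \<partial>M) \<le> (\<integral>\<omega>. (dist (X \<omega>) z)\<^sup>2 \<partial>M)"
      using p by (meson add_increasing2 le_add_same_cancel1 order_trans zero_le_power2)
    fix q assume "\<forall>z. (\<integral>\<omega>. (dist (X \<omega>) q)\<^sup>2 \<partial>M) \<le> (\<integral>\<omega>. (dist (X \<omega>) z)\<^sup>2 \<partial>M)"
    then have "(\<integral>\<omega>. (dist (X \<omega>) q)\<^sup>2 \<partial>M) \<le> (\<integral>\<omega>. (dist (X \<omega>) p)\<^sup>2 \<partial>M)" by blast
    then have "(dist p q)\<^sup>2 \<le> 0"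
      using p[of q] by linarith
    then show "q = p" by simp
  qed
  then show ?thesis
    using p[of z] by (simp add: hvariance_def)
qed

end

section \<open>Separably valued random variables\<close>

text \<open>
  Without separability the product of two Borel \<open>\<sigma>\<close>-algebras can be smaller than the Borel
  \<open>\<sigma>\<close>-algebra of the product, so that a continuous function of two measurable maps may fail to be
  measurable. Asking for values in a separable set everywhere, not just almost everywhere, gives a
  class that is closed under continuous operations.
\<close>

definition separable_rv :: "'b measure \<Rightarrow> ('b \<Rightarrow> 'a::metric_space) \<Rightarrow> bool" where
  "separable_rv N X \<longleftrightarrow>
     X \<in> borel_measurable N \<and> (\<exists>C. countable C \<and> (\<forall>\<omega>\<in>space N. X \<omega> \<in> closure C))"

lemma separable_rv_measurable: "separable_rv N X \<Longrightarrow> X \<in> borel_measurable N"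
  by (simp add: separable_rv_def)

text \<open>
  The index \<open>I m \<omega>\<close> selects the first point of a countable dense set that is within \<open>1 / (m + 1)\<close> of
  \<open>X \<omega>\<close>. Since indices live in a countable discrete space, pairs of them cause no measurability
  problem.
\<close>

lemma separable_rv_approx:
  assumes X: "separable_rv N X"
  shows "\<exists>c I. (\<forall>m. I m \<in> measurable N (count_space UNIV)) \<and>
    (\<forall>\<omega>\<in>space N. (\<lambda>m. c (I m \<omega> :: nat)) \<longlonglongrightarrow> X \<omega>)"
proof -
  have [measurable]: "X \<in> borel_measurable N" using X by (simp add: separable_rv_def)
  obtain C where C: "countable C" "\<And>\<omega>. \<omega> \<in> space N \<Longrightarrow> X \<omega> \<in> closure C"
    using X unfolding separable_rv_def by blast
  let ?c = "from_nat_into C"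
  define I where "I m \<omega> = (LEAST i. dist (X \<omega>) (?c i) < 1 / real (Suc m))" for m \<omega>
  have "I m \<in> measurable N (count_space UNIV)" for m
    unfolding I_def by measurable
  moreover have "(\<lambda>m. ?c (I m \<omega>)) \<longlonglongrightarrow> X \<omega>" if \<omega>: "\<omega> \<in> space N" for \<omega>
  proof -
    have "\<exists>i. dist (X \<omega>) (?c i) < e" if "e > 0" for e
    proof -
      obtain y where "y \<in> C" "dist y (X \<omega>) < e"
        using C(2)[OF \<omega>] \<open>e > 0\<close> closure_approachable by blast
      moreover obtain i where "?c i = y"
        using from_nat_into_surj[OF C(1) \<open>y \<in> C\<close>] by blast
      ultimately show ?thesis by (auto simp: dist_commute)
    qed
    then have "dist (X \<omega>) (?c (I m \<omega>)) < 1 / real (Suc m)" for m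
      unfolding I_def by (rule LeastI_ex) simp
    then have le: "norm (dist (?c (I m \<omega>)) (X \<omega>)) \<le> 1 / real (Suc m)" for m
      by (simp add: dist_commute less_imp_le)
    have "(\<lambda>m. 1 / real (Suc m)) \<longlonglongrightarrow> 0"
      by (intro LIMSEQ_Suc lim_1_over_n)
    then have "(\<lambda>m. dist (?c (I m \<omega>)) (X \<omega>)) \<longlonglongrightarrow> 0"
      by (rule Lim_null_comparison[rotated]) (rule always_eventually[OF allI[OF le]])
    then show ?thesis
      by (subst tendsto_dist_iff)
  qed
  ultimately show ?thesis by blast
qed

lemma separable_rv_continuous2:
  fixes g :: "'a::metric_space \<Rightarrow> 'b::metric_space \<Rightarrow> 'c::metric_space"
  assumes X: "separable_rv N X" and Y: "separable_rv N Y"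
    and g: "continuous_on UNIV (\<lambda>(x, y). g x y)"
  shows "separable_rv N (\<lambda>\<omega>. g (X \<omega>) (Y \<omega>))"
proof -
  let ?G = "\<lambda>(x, y). g x y"
  obtain c I where I [measurable]: "\<And>m. I m \<in> measurable N (count_space UNIV)"
    and cI: "\<And>\<omega>. \<omega> \<in> space N \<Longrightarrow> (\<lambda>m. c (I m \<omega> :: nat)) \<longlonglongrightarrow> X \<omega>"
    using separable_rv_approx[OF X] by blast
  obtain d J where J [measurable]: "\<And>m. J m \<in> measurable N (count_space UNIV)"
    and dJ: "\<And>\<omega>. \<omega> \<in> space N \<Longrightarrow> (\<lambda>m. d (J m \<omega> :: nat)) \<longlonglongrightarrow> Y \<omega>"
    using separable_rv_approx[OF Y] by blast
  have "(\<lambda>\<omega>. g (X \<omega>) (Y \<omega>)) \<in> borel_measurable N"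
  proof (rule borel_measurable_LIMSEQ_metric)
    show "(\<lambda>\<omega>. g (c (I m \<omega>)) (d (J m \<omega>))) \<in> borel_measurable N" for m
      by (rule measurable_compose_countable[OF _ I], rule measurable_compose_countable[OF _ J]) simp
    show "(\<lambda>m. g (c (I m \<omega>)) (d (J m \<omega>))) \<longlonglongrightarrow> g (X \<omega>) (Y \<omega>)" if "\<omega> \<in> space N" for \<omega>
      using continuous_on_tendsto_compose[OF g tendsto_Pair[OF cI[OF that] dJ[OF that]]] by simp
  qed
  moreover obtain C D where CD: "countable C" "\<And>\<omega>. \<omega> \<in> space N \<Longrightarrow> X \<omega> \<in> closure C"
      "countable D" "\<And>\<omega>. \<omega> \<in> space N \<Longrightarrow> Y \<omega> \<in> closure D"
    using X Y unfolding separable_rv_def by metis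
  moreover have "?G ` closure (C \<times> D) \<subseteq> closure (?G ` (C \<times> D))"
    by (rule image_closure_subset) (auto intro: closure_subset[THEN subsetD] continuous_on_subset[OF g])
  then have "g (X \<omega>) (Y \<omega>) \<in> closure (?G ` (C \<times> D))" if "\<omega> \<in> space N" for \<omega>
    using CD(2,4)[OF that] unfolding closure_Times by (force simp: image_subset_iff)
  moreover have "countable (?G ` (C \<times> D))" using CD by simp
  ultimately show ?thesis
    unfolding separable_rv_def by blast
qed

lemma separable_rv_compose:
  "separable_rv N X \<Longrightarrow> h \<in> measurable P N \<Longrightarrow> separable_rv P (\<lambda>\<omega>. X (h \<omega>))"
  unfolding separable_rv_def using measurable_compose[of h P N X borel] measurable_space[of h P N] by blast

text \<open>
  The retraction serves two purposes: it turns an almost separably valued variable into a separably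
  valued one by composition with a fixed map, which preserves independence, and it makes functions
  such as the distance measurable on the product \<open>\<sigma>\<close>-algebra without changing them where they are
  evaluated.
\<close>

lemma separable_retraction_exists:
  assumes "countable C"
  shows "\<exists>r::'a::metric_space \<Rightarrow> 'a. separable_rv borel r \<and> (\<forall>x\<in>closure C. r x = x)"
proof -
  obtain a :: 'a where True by simp
  let ?r = "\<lambda>x. if x \<in> closure C then x else a"
  have "{x \<in> space borel. x \<in> closure C} \<in> sets borel"
    by simp
  then have "?r \<in> borel_measurable borel"
    by (rule measurable_If[rotated 2]) simp_all
  moreover have "\<forall>x. ?r x \<in> closure (insert a C)"
    using closure_mono[of C "insert a C"] closure_subset[of "insert a C"] by auto
  moreover have "countable (insert a C)" using assms by simp
  ultimately have "separable_rv borel ?r"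
    unfolding separable_rv_def by blast
  then show ?thesis by (intro exI[of _ ?r]) simp
qed

text \<open>
  By independence, the right-hand side is a double integral over the laws of \<open>S\<close> and \<open>Y\<close>. For each
  fixed value \<open>s\<close> of \<open>S\<close>, the variance inequality for \<open>Y\<close> bounds the inner integral from below by
  \<open>hvariance M Y + (dist s (hexpectation M Y))\<^sup>2\<close>.
\<close>

lemma (in prob_space) indep_sq_dist_ge:
  fixes S Y :: "'a \<Rightarrow> 'c::hadamard_space"
  assumes indep: "indep_var borel S borel Y"
    and S: "separable_rv M S" and Y: "separable_rv M Y"
    and sqS: "square_integrable_rv M S" and sqY: "square_integrable_rv M Y"
  shows "integrable M (\<lambda>\<omega>. (dist (S \<omega>) (Y \<omega>))\<^sup>2)"
    and "hvariance M Y + (\<integral>\<omega>. (dist (S \<omega>) (hexpectation M Y))\<^sup>2 \<partial>M)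
      \<le> (\<integral>\<omega>. (dist (S \<omega>) (Y \<omega>))\<^sup>2 \<partial>M)"
proof -
  define V m where "V = hvariance M Y" and "m = hexpectation M Y"
  have V: "0 \<le> V" by (simp add: V_def hvariance_def)
  have var: "V + (dist m z)\<^sup>2 \<le> (\<integral>\<omega>. (dist (Y \<omega>) z)\<^sup>2 \<partial>M)" for z
    unfolding V_def m_def by (rule variance_inequality[OF sqY])
  have [measurable]: "S \<in> borel_measurable M" "Y \<in> borel_measurable M"
    using S Y by (auto dest: separable_rv_measurable)
  have dist_cont: "continuous_on UNIV (\<lambda>(x::'c, y). (dist x y)\<^sup>2)"
    by (auto simp: case_prod_unfold intro!: continuous_intros)
  have [measurable]: "(\<lambda>\<omega>. (dist (S \<omega>) (Y \<omega>))\<^sup>2) \<in> borel_measurable M"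
    using separable_rv_continuous2[OF S Y dist_cont] by (rule separable_rv_measurable)
  note intS = square_integrable_rvD(2)[OF sqS, of m]
  note intY = square_integrable_rvD(2)[OF sqY]
  show int: "integrable M (\<lambda>\<omega>. (dist (S \<omega>) (Y \<omega>))\<^sup>2)"
  proof (rule Bochner_Integration.integrable_bound)
    show "integrable M (\<lambda>\<omega>. 2 * (dist (S \<omega>) m)\<^sup>2 + 2 * (dist (Y \<omega>) m)\<^sup>2)"
      using intS intY by simp
    show "AE \<omega> in M. norm ((dist (S \<omega>) (Y \<omega>))\<^sup>2) \<le> norm (2 * (dist (S \<omega>) m)\<^sup>2 + 2 * (dist (Y \<omega>) m)\<^sup>2)"
      using dist_square_le[of "S _" "Y _" m] by (auto simp: dist_commute)
  qed simp
  \<comment> \<open>The distance itself need not be measurable on \<open>borel \<Otimes>\<^sub>M borel\<close>; after retracting both arguments it is.\<close>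
  obtain C where C: "countable C" "\<And>\<omega>. \<omega> \<in> space M \<Longrightarrow> S \<omega> \<in> closure C"
    using S unfolding separable_rv_def by blast
  obtain r :: "'c \<Rightarrow> 'c" where r: "separable_rv borel r" "\<And>x. x \<in> closure C \<Longrightarrow> r x = x"
    using separable_retraction_exists[OF C(1)] by blast
  obtain D where D: "countable D" "\<And>\<omega>. \<omega> \<in> space M \<Longrightarrow> Y \<omega> \<in> closure D"
    using Y unfolding separable_rv_def by blast
  obtain q :: "'c \<Rightarrow> 'c" where q: "separable_rv borel q" "\<And>x. x \<in> closure D \<Longrightarrow> q x = x"
    using separable_retraction_exists[OF D(1)] by blast
  have [measurable]: "q \<in> borel_measurable borel" "r \<in> borel_measurable borel"
    using r q by (auto dest: separable_rv_measurable)
  have "separable_rv (borel \<Otimes>\<^sub>M borel) (\<lambda>p::'c \<times> 'c. (dist (r (fst p)) (q (snd p)))\<^sup>2)"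
    by (intro separable_rv_continuous2[OF _ _ dist_cont] separable_rv_compose[OF r(1)]
        separable_rv_compose[OF q(1)]) measurable
  then have f [measurable]:
      "(\<lambda>p::'c \<times> 'c. ennreal ((dist (r (fst p)) (q (snd p)))\<^sup>2)) \<in> borel_measurable (borel \<Otimes>\<^sub>M borel)"
    by (intro measurable_compose[OF _ measurable_ennreal] separable_rv_measurable)
  interpret DY: prob_space "distr M borel Y" by (rule prob_space_distr) simp
  let ?g = "\<lambda>s. \<integral>\<^sup>+y. ennreal ((dist (r s) (q y))\<^sup>2) \<partial>distr M borel Y"
  have f': "(\<lambda>p. ennreal ((dist (r (fst p)) (q (snd p)))\<^sup>2))
      \<in> borel_measurable (distr M borel S \<Otimes>\<^sub>M distr M borel Y)"
    using f by (simp cong: measurable_cong_sets sets_pair_measure_cong)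
  have g: "?g \<in> borel_measurable borel"
    using DY.borel_measurable_nn_integral_fst[OF f'] by (simp cong: measurable_cong_sets)
  have "ennreal (V + (\<integral>\<omega>. (dist (S \<omega>) m)\<^sup>2 \<partial>M)) = (\<integral>\<^sup>+\<omega>. ennreal (V + (dist (S \<omega>) m)\<^sup>2) \<partial>M)"
    using intS V by (subst nn_integral_eq_integral) (auto simp: prob_space)
  also have "\<dots> \<le> (\<integral>\<^sup>+\<omega>. \<integral>\<^sup>+\<omega>'. ennreal ((dist (S \<omega>) (Y \<omega>'))\<^sup>2) \<partial>M \<partial>M)"
  proof (rule nn_integral_mono)
    fix \<omega>
    have "(\<integral>\<^sup>+\<omega>'. ennreal ((dist (S \<omega>) (Y \<omega>'))\<^sup>2) \<partial>M) = ennreal (\<integral>\<omega>'. (dist (Y \<omega>') (S \<omega>))\<^sup>2 \<partial>M)"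
      using intY[of "S \<omega>"] by (subst nn_integral_eq_integral[symmetric]) (auto simp: dist_commute)
    then show "ennreal (V + (dist (S \<omega>) m)\<^sup>2) \<le> (\<integral>\<^sup>+\<omega>'. ennreal ((dist (S \<omega>) (Y \<omega>'))\<^sup>2) \<partial>M)"
      using var[of "S \<omega>"] by (simp add: dist_commute ennreal_leI)
  qed
  also have "\<dots> = (\<integral>\<^sup>+\<omega>. \<integral>\<^sup>+\<omega>'. ennreal ((dist (r (S \<omega>)) (q (Y \<omega>')))\<^sup>2) \<partial>M \<partial>M)"
    using r q C D by (intro nn_integral_cong) simp
  also have "\<dots> = (\<integral>\<^sup>+\<omega>. ?g (S \<omega>) \<partial>M)"
  proof (intro nn_integral_cong)
    fix \<omega>
    have "(\<lambda>y. ennreal ((dist (r (S \<omega>)) (q y))\<^sup>2)) \<in> borel_measurable borel"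
      using measurable_compose[OF measurable_Pair1'[of "S \<omega>" borel borel] f] by simp
    then show "(\<integral>\<^sup>+\<omega>'. ennreal ((dist (r (S \<omega>)) (q (Y \<omega>')))\<^sup>2) \<partial>M) = ?g (S \<omega>)"
      by (subst nn_integral_distr) simp_all
  qed
  also have "\<dots> = (\<integral>\<^sup>+s. ?g s \<partial>distr M borel S)"
    by (rule nn_integral_distr[symmetric]) (simp_all add: g)
  also have "\<dots> = (\<integral>\<^sup>+p. ennreal ((dist (r (fst p)) (q (snd p)))\<^sup>2) \<partial>(distr M borel S \<Otimes>\<^sub>M distr M borel Y))"
    using DY.nn_integral_fst[OF f'] by simp
  also have "\<dots> = (\<integral>\<^sup>+p. ennreal ((dist (r (fst p)) (q (snd p)))\<^sup>2) \<partial>distr M (borel \<Otimes>\<^sub>M borel) (\<lambda>\<omega>. (S \<omega>, Y \<omega>)))"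
    using indep by (simp add: indep_var_distribution_eq)
  also have "\<dots> = (\<integral>\<^sup>+\<omega>. ennreal ((dist (r (S \<omega>)) (q (Y \<omega>)))\<^sup>2) \<partial>M)"
    by (subst nn_integral_distr) (simp_all only: measurable_distr_eq1 f, simp_all)
  also have "\<dots> = (\<integral>\<^sup>+\<omega>. ennreal ((dist (S \<omega>) (Y \<omega>))\<^sup>2) \<partial>M)"
    using r q C D by (intro nn_integral_cong) simp
  also have "\<dots> = ennreal (\<integral>\<omega>. (dist (S \<omega>) (Y \<omega>))\<^sup>2 \<partial>M)"
    using int by (subst nn_integral_eq_integral) auto
  finally show "hvariance M Y + (\<integral>\<omega>. (dist (S \<omega>) (hexpectation M Y))\<^sup>2 \<partial>M)
      \<le> (\<integral>\<omega>. (dist (S \<omega>) (Y \<omega>))\<^sup>2 \<partial>M)"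
    unfolding V_def m_def by simp
qed

section \<open>Inductive means of random variables\<close>

lemma separable_rv_inductive_mean:
  assumes "\<And>k. k \<ge> 1 \<Longrightarrow> separable_rv N (Y k)" and "n \<ge> 1"
  shows "separable_rv N (\<lambda>\<omega>. inductive_mean (\<lambda>k. Y k \<omega>) n)"
  using assms(2)
proof (induction n rule: nat_induct_at_least)
  case base
  then show ?case using assms(1)[of 1] by simp
next
  case (Suc n)
  then obtain m where n: "n = Suc m" by (cases n) auto
  have "separable_rv N (Y (Suc (Suc m)))" by (rule assms(1)) simp
  then show ?case
    unfolding n inductive_mean.simps
    by (rule separable_rv_continuous2[OF Suc.IH[unfolded n]])
      (rule continuous_on_geodesic_point; simp)
qed

lemma inductive_mean_cong:
  "(\<And>k. k \<in> {1..n} \<Longrightarrow> x k = y k) \<Longrightarrow> inductive_mean x n = inductive_mean y n"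
proof (induction n)
  case (Suc n)
  then show ?case by (cases n) simp_all
qed simp

lemma inductive_mean_Suc:
  "n \<ge> 1 \<Longrightarrow> inductive_mean x (Suc n) = geodesic_point (inductive_mean x n) (1 / real (Suc n)) (x (Suc n))"
  by (cases n) auto

context prob_space
begin

text \<open>
  The inductive mean of the first \<open>n\<close> variables must be a measurable function of the vector
  \<open>(X 1, \<dots>, X n)\<close> with respect to the product \<open>\<sigma>\<close>-algebra, so that independence of \<open>X (Suc n)\<close> from the
  vector carries over. This is the reason for writing the variables as \<open>g k (X k)\<close> with
  separably valued \<open>g k\<close>.
\<close>

lemma indep_var_inductive_mean:
  fixes X :: "nat \<Rightarrow> 'a \<Rightarrow> 'c::hadamard_space"
  assumes indep: "indep_vars (\<lambda>_. borel) X {1..}"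
    and g: "\<And>k. separable_rv borel (g k)" and n: "n \<ge> 1"
  shows "indep_var borel (\<lambda>\<omega>. inductive_mean (\<lambda>k. g k (X k \<omega>)) n) borel (\<lambda>\<omega>. g (Suc n) (X (Suc n) \<omega>))"
proof -
  let ?F = "\<lambda>x. inductive_mean (\<lambda>k. g k (x k)) n"
  let ?P = "\<lambda>I. PiM I (\<lambda>_. borel)"
  have comp: "(\<lambda>x. x k) \<in> measurable (?P I) borel" if "k \<in> I" for k I
    using that by simp
  \<comment> \<open>Coordinates outside \<open>{1..n}\<close> are replaced by a constant, so that all of them are measurable.\<close>
  have "(\<lambda>x. inductive_mean (\<lambda>k. g k (if k \<in> {1..n} then x k else undefined)) n) \<in> borel_measurable (?P {1..n})"
  proof (intro separable_rv_measurable separable_rv_inductive_mean n)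
    fix k
    show "separable_rv (?P {1..n}) (\<lambda>x. g k (if k \<in> {1..n} then x k else undefined))"
      by (cases "k \<in> {1..n}") (auto intro!: separable_rv_compose[OF g] comp)
  qed
  also have "(\<lambda>x. inductive_mean (\<lambda>k. g k (if k \<in> {1..n} then x k else undefined)) n) = ?F"
    by (intro ext inductive_mean_cong) simp
  finally have F: "?F \<in> borel_measurable (?P {1..n})" .
  have G: "(\<lambda>x. g (Suc n) (x (Suc n))) \<in> borel_measurable (?P {Suc n})"
    by (rule measurable_compose[OF comp separable_rv_measurable[OF g]]) simp
  have "indep_var (?P {1..n}) (\<lambda>\<omega>. restrict (\<lambda>k. X k \<omega>) {1..n}) (?P {Suc n}) (\<lambda>\<omega>. restrict (\<lambda>k. X k \<omega>) {Suc n})"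
    by (rule indep_var_restrict[OF indep]) auto
  from indep_var_compose[OF this F G]
  have "indep_var borel (\<lambda>\<omega>. ?F (restrict (\<lambda>k. X k \<omega>) {1..n})) borel (\<lambda>\<omega>. g (Suc n) (X (Suc n) \<omega>))"
    by (simp add: comp_def)
  also have "(\<lambda>\<omega>. ?F (restrict (\<lambda>k. X k \<omega>) {1..n})) = (\<lambda>\<omega>. inductive_mean (\<lambda>k. g k (X k \<omega>)) n)"
    by (intro ext inductive_mean_cong) simp
  finally show ?thesis .
qed

lemma square_integrable_geodesic_point:
  fixes S Y :: "'a \<Rightarrow> 'c::hadamard_space"
  assumes sep: "separable_rv M S" "separable_rv M Y"
    and sq: "square_integrable_rv M S" "square_integrable_rv M Y"
    and t: "0 \<le> t" "t \<le> 1"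
  shows "square_integrable_rv M (\<lambda>\<omega>. geodesic_point (S \<omega>) t (Y \<omega>))"
proof -
  let ?P = "\<lambda>\<omega>. geodesic_point (S \<omega>) t (Y \<omega>)"
  have P [measurable]: "?P \<in> borel_measurable M"
    using separable_rv_continuous2[OF sep continuous_on_geodesic_point[OF t]]
    by (rule separable_rv_measurable)
  have "integrable M (\<lambda>\<omega>. (dist (?P \<omega>) z)\<^sup>2)" for z
  proof (rule Bochner_Integration.integrable_bound)
    show "integrable M (\<lambda>\<omega>. (1 - t) * (dist (S \<omega>) z)\<^sup>2 + t * (dist (Y \<omega>) z)\<^sup>2)"
      using sq by (simp add: square_integrable_rvD(2))
    have "(dist (?P \<omega>) z)\<^sup>2 \<le> (1 - t) * (dist (S \<omega>) z)\<^sup>2 + t * (dist (Y \<omega>) z)\<^sup>2" for \<omega>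
    proof -
      have "0 \<le> t * (1 - t) * (dist (S \<omega>) (Y \<omega>))\<^sup>2" using t by simp
      then show ?thesis
        using geodesic_point_cat0(3)[OF t, of z "S \<omega>" "Y \<omega>"] by (simp add: dist_commute)
    qed
    then show "AE \<omega> in M. norm ((dist (?P \<omega>) z)\<^sup>2) \<le> norm ((1 - t) * (dist (S \<omega>) z)\<^sup>2 + t * (dist (Y \<omega>) z)\<^sup>2)"
      using t by simp
  qed simp
  then show ?thesis
    using P unfolding square_integrable_rv_def by blast
qed

lemma expected_sq_dist_le:
  fixes Y :: "'a \<Rightarrow> 'c::hadamard_space"
  assumes sq: "square_integrable_rv M Y"
  defines "m \<equiv> hexpectation M Y"
  shows "(\<integral>\<omega>. (dist (Y \<omega>) z)\<^sup>2 \<partial>M)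
    \<le> hvariance M Y + 2 * dist m z * (\<integral>\<omega>. dist (Y \<omega>) m \<partial>M) + (dist m z)\<^sup>2"
proof -
  note int [simp] = square_integrable_rvD(2,3)[OF sq]
  have "(\<integral>\<omega>. (dist (Y \<omega>) z)\<^sup>2 \<partial>M)
      \<le> (\<integral>\<omega>. (dist (Y \<omega>) m)\<^sup>2 + 2 * dist m z * dist (Y \<omega>) m + (dist m z)\<^sup>2 \<partial>M)"
  proof (rule integral_mono)
    fix \<omega>
    have "(dist (Y \<omega>) z)\<^sup>2 \<le> (dist (Y \<omega>) m + dist m z)\<^sup>2"
      by (intro power_mono dist_triangle) simp
    then show "(dist (Y \<omega>) z)\<^sup>2 \<le> (dist (Y \<omega>) m)\<^sup>2 + 2 * dist m z * dist (Y \<omega>) m + (dist m z)\<^sup>2"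
      by (simp add: power2_sum mult_ac)
  qed simp_all
  also have "\<dots> = hvariance M Y + 2 * dist m z * (\<integral>\<omega>. dist (Y \<omega>) m \<partial>M) + (dist m z)\<^sup>2"
    by (simp add: hvariance_def m_def prob_space)
  finally show ?thesis .
qed

text \<open>
  Integrating the CAT(0) inequality gives \<open>E d(P,\<mu>)\<^sup>2 \<le> (1 - t) E d(S,\<mu>)\<^sup>2 + t E d(Y,\<mu>)\<^sup>2 - t (1 - t) E d(S,Y)\<^sup>2\<close>
  for the geodesic point \<open>P\<close>. The last term is bounded with the variance of \<open>Y\<close> by independence, and
  then \<open>E d(S,m)\<^sup>2\<close> and \<open>E d(Y,\<mu>)\<^sup>2\<close> are compared with \<open>E d(S,\<mu>)\<^sup>2\<close> and \<open>E d(Y,m)\<^sup>2\<close> by the triangle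
  inequality. The variance of \<open>Y\<close> ends up with coefficient \<open>t - t (1 - t) = t\<^sup>2\<close>, and all other errors
  contain the factor \<open>\<delta>\<close>, the distance of \<open>\<mu>\<close> from the expectation of \<open>Y\<close>.
\<close>

lemma expected_sq_dist_geodesic_point:
  fixes S Y :: "'a \<Rightarrow> 'c::hadamard_space" and m \<mu> :: 'c
  assumes indep: "indep_var borel S borel Y"
    and sep: "separable_rv M S" "separable_rv M Y"
    and sq: "square_integrable_rv M S" "square_integrable_rv M Y"
    and t: "0 \<le> t" "t \<le> 1"
    and m: "hexpectation M Y = m"
  defines "\<delta> \<equiv> dist m \<mu>"
  shows "(\<integral>\<omega>. (dist (geodesic_point (S \<omega>) t (Y \<omega>)) \<mu>)\<^sup>2 \<partial>M)
    \<le> (1 - t)\<^sup>2 * (\<integral>\<omega>. (dist (S \<omega>) \<mu>)\<^sup>2 \<partial>M) + t\<^sup>2 * (hvariance M Y + \<delta>\<^sup>2)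
      + 2 * t * \<delta> * (\<integral>\<omega>. dist (Y \<omega>) m \<partial>M) + 2 * t * (1 - t) * \<delta> * (\<integral>\<omega>. dist (S \<omega>) \<mu> \<partial>M)"
proof -
  note int [simp] = square_integrable_rvD(2,3)[OF sq(1)] square_integrable_rvD(2,3)[OF sq(2)]
  let ?V = "hvariance M Y" and ?A = "\<integral>\<omega>. (dist (S \<omega>) \<mu>)\<^sup>2 \<partial>M"
    and ?E = "\<integral>\<omega>. dist (S \<omega>) \<mu> \<partial>M" and ?e = "\<integral>\<omega>. dist (Y \<omega>) m \<partial>M"
  note SY = indep_sq_dist_ge[OF indep sep sq, unfolded m]
  note [simp] = SY(1)
  have [simp]: "integrable M (\<lambda>\<omega>. (dist (geodesic_point (S \<omega>) t (Y \<omega>)) \<mu>)\<^sup>2)"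
    by (intro square_integrable_rvD(2) square_integrable_geodesic_point sep sq t)
  have "(\<integral>\<omega>. (dist (geodesic_point (S \<omega>) t (Y \<omega>)) \<mu>)\<^sup>2 \<partial>M)
      \<le> (\<integral>\<omega>. (1 - t) * (dist (S \<omega>) \<mu>)\<^sup>2 + t * (dist (Y \<omega>) \<mu>)\<^sup>2 - t * (1 - t) * (dist (S \<omega>) (Y \<omega>))\<^sup>2 \<partial>M)"
  proof (rule integral_mono)
    show "(dist (geodesic_point (S \<omega>) t (Y \<omega>)) \<mu>)\<^sup>2
        \<le> (1 - t) * (dist (S \<omega>) \<mu>)\<^sup>2 + t * (dist (Y \<omega>) \<mu>)\<^sup>2 - t * (1 - t) * (dist (S \<omega>) (Y \<omega>))\<^sup>2" for \<omega>
      using geodesic_point_cat0(3)[OF t, of \<mu> "S \<omega>" "Y \<omega>"] by (simp add: dist_commute)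
  qed simp_all
  also have "\<dots> = (1 - t) * ?A + t * (\<integral>\<omega>. (dist (Y \<omega>) \<mu>)\<^sup>2 \<partial>M)
      - t * (1 - t) * (\<integral>\<omega>. (dist (S \<omega>) (Y \<omega>))\<^sup>2 \<partial>M)"
    by simp
  also have "\<dots> \<le> (1 - t) * ?A + t * (?V + 2 * \<delta> * ?e + \<delta>\<^sup>2) - t * (1 - t) * (?V + (?A - 2 * \<delta> * ?E + \<delta>\<^sup>2))"
  proof (intro add_mono diff_mono mult_left_mono order_refl)
    show "(\<integral>\<omega>. (dist (Y \<omega>) \<mu>)\<^sup>2 \<partial>M) \<le> ?V + 2 * \<delta> * ?e + \<delta>\<^sup>2"
      using expected_sq_dist_le[OF sq(2), of \<mu>] by (simp add: m \<delta>_def)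
    have "?A - 2 * \<delta> * ?E + \<delta>\<^sup>2 = (\<integral>\<omega>. (dist (S \<omega>) \<mu>)\<^sup>2 - 2 * \<delta> * dist (S \<omega>) \<mu> + \<delta>\<^sup>2 \<partial>M)"
      by (simp add: prob_space)
    also have "\<dots> \<le> (\<integral>\<omega>. (dist (S \<omega>) m)\<^sup>2 \<partial>M)"
    proof (rule integral_mono)
      fix \<omega>
      have "\<bar>dist (S \<omega>) \<mu> - \<delta>\<bar> \<le> dist (S \<omega>) m"
        unfolding \<delta>_def by (metis abs_dist_diff_le dist_commute)
      then have "\<bar>dist (S \<omega>) \<mu> - \<delta>\<bar>\<^sup>2 \<le> (dist (S \<omega>) m)\<^sup>2"
        by (intro power_mono) auto
      then show "(dist (S \<omega>) \<mu>)\<^sup>2 - 2 * \<delta> * dist (S \<omega>) \<mu> + \<delta>\<^sup>2 \<le> (dist (S \<omega>) m)\<^sup>2"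
        by (simp add: power2_diff algebra_simps)
    qed simp_all
    finally show "?V + (?A - 2 * \<delta> * ?E + \<delta>\<^sup>2) \<le> (\<integral>\<omega>. (dist (S \<omega>) (Y \<omega>))\<^sup>2 \<partial>M)"
      using SY(2) by linarith
  qed (use t in auto)
  also have "\<dots> = (1 - t)\<^sup>2 * ?A + t\<^sup>2 * (?V + \<delta>\<^sup>2) + 2 * t * \<delta> * ?e + 2 * t * (1 - t) * \<delta> * ?E"
    by (simp add: power2_eq_square algebra_simps)
  finally show ?thesis .
qed

lemma square_integrable_inductive_mean:
  fixes Y :: "nat \<Rightarrow> 'a \<Rightarrow> 'c::hadamard_space"
  assumes sep: "\<And>k. k \<ge> 1 \<Longrightarrow> separable_rv M (Y k)"
    and sq: "\<And>k. k \<ge> 1 \<Longrightarrow> square_integrable_rv M (Y k)" and "n \<ge> 1"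
  shows "square_integrable_rv M (\<lambda>\<omega>. inductive_mean (\<lambda>k. Y k \<omega>) n)"
  using \<open>n \<ge> 1\<close>
proof (induction n rule: nat_induct_at_least)
  case base
  then show ?case using sq[of 1] by simp
next
  case (Suc n)
  show ?case
    unfolding inductive_mean_Suc[OF Suc.hyps]
    by (intro square_integrable_geodesic_point separable_rv_inductive_mean sep Suc sq) auto
qed

text \<open>
  The distance to a fixed point is convex along geodesics. In the recursion below, the bound is
  applied to the factor \<open>E d(S\<^sub>n,\<mu>)\<close> that multiplies the bias.
\<close>

lemma expected_dist_inductive_mean_le:
  fixes Y :: "nat \<Rightarrow> 'a \<Rightarrow> 'c::hadamard_space"
  assumes sep: "\<And>k. k \<ge> 1 \<Longrightarrow> separable_rv M (Y k)"
    and sq: "\<And>k. k \<ge> 1 \<Longrightarrow> square_integrable_rv M (Y k)" and "n \<ge> 1"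
    and bound: "\<And>k. k \<in> {1..n} \<Longrightarrow> (\<integral>\<omega>. dist (Y k \<omega>) z \<partial>M) \<le> B"
  shows "(\<integral>\<omega>. dist (inductive_mean (\<lambda>k. Y k \<omega>) n) z \<partial>M) \<le> B"
  using \<open>n \<ge> 1\<close> bound
proof (induction n rule: nat_induct_at_least)
  case base
  then show ?case by simp
next
  case (Suc n)
  let ?S = "\<lambda>n \<omega>. inductive_mean (\<lambda>k. Y k \<omega>) n" and ?t = "1 / real (Suc n)"
  have int [simp]: "integrable M (\<lambda>\<omega>. dist (?S k \<omega>) z)" "integrable M (\<lambda>\<omega>. dist (Y k \<omega>) z)"
    if "k \<ge> 1" for k
    by (rule square_integrable_rvD(3)[OF square_integrable_inductive_mean[OF sep sq that]]
        square_integrable_rvD(3)[OF sq[OF that]]; simp)+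
  have "(\<integral>\<omega>. dist (?S (Suc n) \<omega>) z \<partial>M) \<le> (\<integral>\<omega>. (1 - ?t) * dist (?S n \<omega>) z + ?t * dist (Y (Suc n) \<omega>) z \<partial>M)"
  proof (rule integral_mono)
    fix \<omega>
    show "dist (?S (Suc n) \<omega>) z \<le> (1 - ?t) * dist (?S n \<omega>) z + ?t * dist (Y (Suc n) \<omega>) z"
      using dist_geodesic_point_convex[of ?t z "?S n \<omega>" "Y (Suc n) \<omega>"]
      unfolding inductive_mean_Suc[OF Suc.hyps] by (simp add: dist_commute)
  qed (use Suc.hyps in auto)
  also have "\<dots> = (1 - ?t) * (\<integral>\<omega>. dist (?S n \<omega>) z \<partial>M) + ?t * (\<integral>\<omega>. dist (Y (Suc n) \<omega>) z \<partial>M)"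
    using Suc.hyps by simp
  also have "\<dots> \<le> (1 - ?t) * B + ?t * B"
    using Suc.IH Suc.prems by (intro add_mono mult_left_mono) auto
  also have "\<dots> = B"
    by (simp add: algebra_simps)
  finally show ?case .
qed

text \<open>
  With \<open>t = 1 / (n + 1)\<close>, multiplying the one-step estimate by \<open>(n + 1)\<^sup>2\<close> makes it telescope: writing
  \<open>\<delta>\<close> for the bias, \<open>e\<close> for the mean absolute deviation of \<open>Y (n + 1)\<close> and \<open>E\<close> for \<open>E d(S\<^sub>n,\<mu>)\<close>, the
  quantity \<open>n\<^sup>2 E d(S\<^sub>n,\<mu>)\<^sup>2\<close> grows by at most the variance plus \<open>\<delta> (\<delta> + 2 (n + 1) e + 2 n E)\<close>. Here
  \<open>\<delta>\<close> and \<open>e\<close> are at most \<open>D\<close> and \<open>E\<close> is at most \<open>2 D\<close>, so the bracket is at most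
  \<open>(6 n + 3) D \<le> 6 (n + 1) D\<close>. This is where the constant \<open>6\<close> comes from.
\<close>

lemma expected_sq_dist_inductive_mean:
  fixes Y :: "nat \<Rightarrow> 'a \<Rightarrow> 'c::hadamard_space" and \<nu> :: "nat \<Rightarrow> 'c" and \<mu> :: 'c
  assumes sep: "\<And>k. k \<ge> 1 \<Longrightarrow> separable_rv M (Y k)"
    and sq: "\<And>k. k \<ge> 1 \<Longrightarrow> square_integrable_rv M (Y k)"
    and \<nu>: "\<And>k. k \<ge> 1 \<Longrightarrow> hexpectation M (Y k) = \<nu> k"
    and indep: "\<And>n. n \<ge> 1 \<Longrightarrow>
      indep_var borel (\<lambda>\<omega>. inductive_mean (\<lambda>k. Y k \<omega>) n) borel (Y (Suc n))"
    and "n \<ge> 1"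
    and D: "\<And>k. k \<in> {1..n} \<Longrightarrow> dist (\<nu> k) \<mu> \<le> D"
      "\<And>k. k \<in> {1..n} \<Longrightarrow> (\<integral>\<omega>. dist (Y k \<omega>) (\<nu> k) \<partial>M) \<le> D"
  shows "(real n)\<^sup>2 * (\<integral>\<omega>. (dist (inductive_mean (\<lambda>k. Y k \<omega>) n) \<mu>)\<^sup>2 \<partial>M)
    \<le> (\<Sum>k=1..n. hvariance M (Y k)) + 6 * real n * D * (\<Sum>k=1..n. dist (\<nu> k) \<mu>)"
  using \<open>n \<ge> 1\<close> D
proof (induction n rule: nat_induct_at_least)
  case base
  let ?\<delta> = "dist (\<nu> 1) \<mu>" and ?e = "\<integral>\<omega>. dist (Y 1 \<omega>) (\<nu> 1) \<partial>M"
  have "(\<integral>\<omega>. (dist (Y 1 \<omega>) \<mu>)\<^sup>2 \<partial>M) \<le> hvariance M (Y 1) + 2 * ?\<delta> * ?e + ?\<delta>\<^sup>2"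
    using expected_sq_dist_le[OF sq[of 1], of \<mu>] \<nu>[of 1] by simp
  also have "\<dots> = hvariance M (Y 1) + ?\<delta> * (2 * ?e + ?\<delta>)"
    by (simp add: power2_eq_square algebra_simps)
  also have "?\<delta> * (2 * ?e + ?\<delta>) \<le> ?\<delta> * (6 * D)"
    using base.prems[of 1] order_trans[OF zero_le_dist base.prems(1)[of 1]] by (intro mult_left_mono) auto
  finally show ?case by (simp add: mult_ac)
next
  case (Suc n)
  let ?S = "\<lambda>n \<omega>. inductive_mean (\<lambda>k. Y k \<omega>) n"
  let ?\<delta> = "\<lambda>k. dist (\<nu> k) \<mu>"
  let ?A = "\<lambda>n. \<integral>\<omega>. (dist (?S n \<omega>) \<mu>)\<^sup>2 \<partial>M" and ?E = "\<integral>\<omega>. dist (?S n \<omega>) \<mu> \<partial>M"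
  let ?V = "hvariance M (Y (Suc n))" and ?e = "\<integral>\<omega>. dist (Y (Suc n) \<omega>) (\<nu> (Suc n)) \<partial>M"
  let ?d = "?\<delta> (Suc n)" and ?N = "real (Suc n)"
  have D0: "0 \<le> D" by (rule order_trans[OF zero_le_dist Suc.prems(1)[of "Suc n"]]) simp
  have "?E \<le> 2 * D"
  proof (rule expected_dist_inductive_mean_le[OF sep sq Suc.hyps])
    fix k assume k: "k \<in> {1..n}"
    note int [simp] = square_integrable_rvD(3)[OF sq[of k]]
    have "(\<integral>\<omega>. dist (Y k \<omega>) \<mu> \<partial>M) \<le> (\<integral>\<omega>. dist (Y k \<omega>) (\<nu> k) + ?\<delta> k \<partial>M)"
      using k by (intro integral_mono dist_triangle) auto
    also have "\<dots> = (\<integral>\<omega>. dist (Y k \<omega>) (\<nu> k) \<partial>M) + ?\<delta> k"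
      using k by (simp add: prob_space)
    also have "\<dots> \<le> 2 * D" using Suc.prems(1)[of k] Suc.prems(2)[of k] k by simp
    finally show "(\<integral>\<omega>. dist (Y k \<omega>) \<mu> \<partial>M) \<le> 2 * D" .
  qed
  have step: "?A (Suc n) \<le> (1 - 1 / ?N)\<^sup>2 * ?A n + (1 / ?N)\<^sup>2 * (?V + ?d\<^sup>2)
      + 2 * (1 / ?N) * ?d * ?e + 2 * (1 / ?N) * (1 - 1 / ?N) * ?d * ?E"
    unfolding inductive_mean_Suc[OF Suc.hyps]
    by (intro expected_sq_dist_geodesic_point indep separable_rv_inductive_mean sep sq
        square_integrable_inductive_mean \<nu> Suc.hyps) auto
  have "?N\<^sup>2 * ?A (Suc n) \<le> ?N\<^sup>2 * ((1 - 1 / ?N)\<^sup>2 * ?A n + (1 / ?N)\<^sup>2 * (?V + ?d\<^sup>2)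
      + 2 * (1 / ?N) * ?d * ?e + 2 * (1 / ?N) * (1 - 1 / ?N) * ?d * ?E)"
    using step by (rule mult_left_mono) simp
  also have "\<dots> = (?N * (1 - 1 / ?N))\<^sup>2 * ?A n + (?N * (1 / ?N))\<^sup>2 * (?V + ?d\<^sup>2)
      + 2 * (?N * (1 / ?N)) * ?N * ?d * ?e + 2 * (?N * (1 / ?N)) * (?N * (1 - 1 / ?N)) * ?d * ?E"
    by (simp only: power2_eq_square distrib_left mult_ac)
  also have "\<dots> = (real n)\<^sup>2 * ?A n + ?V + ?d * (?d + 2 * ?N * ?e + 2 * real n * ?E)"
  proof -
    have "?N * (1 - 1 / ?N) = real n" "?N * (1 / ?N) = 1"
      by (simp_all add: field_simps)
    then show ?thesis by (simp only:) (simp add: power2_eq_square algebra_simps)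
  qed
  also have "?d * (?d + 2 * ?N * ?e + 2 * real n * ?E) \<le> ?d * (D + 2 * ?N * D + 2 * real n * (2 * D))"
    using \<open>?E \<le> 2 * D\<close> Suc.prems(1)[of "Suc n"] Suc.prems(2)[of "Suc n"]
    by (intro mult_left_mono add_mono) auto
  also have "\<dots> \<le> 6 * ?N * D * ?d"
    using mult_nonneg_nonneg[OF D0 zero_le_dist[of "\<nu> (Suc n)" \<mu>]] by (simp add: algebra_simps)
  finally have "?N\<^sup>2 * ?A (Suc n) \<le> (real n)\<^sup>2 * ?A n + ?V + 6 * ?N * D * ?d" by simp
  also have "(real n)\<^sup>2 * ?A n \<le> (\<Sum>k=1..n. hvariance M (Y k)) + 6 * real n * D * (\<Sum>k=1..n. ?\<delta> k)"
    by (rule Suc.IH) (use Suc.prems in auto)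
  also have "6 * real n * D * (\<Sum>k=1..n. ?\<delta> k) \<le> 6 * ?N * D * (\<Sum>k=1..n. ?\<delta> k)"
    using D0 by (intro mult_right_mono sum_nonneg) auto
  finally show ?case
    by (simp add: algebra_simps)
qed

end

section \<open>The weak law with varying expectations\<close>

theorem theorem1:
  fixes M :: "'b measure"
    and X :: "nat \<Rightarrow> 'b \<Rightarrow> 'a::hadamard_space"
    and \<nu> :: "nat \<Rightarrow> 'a"
    and \<mu> :: 'a
    and n :: nat
  assumes "prob_space M"
    and "prob_space.indep_vars M (\<lambda>_. borel) X {1..}"
    and "\<And>k. k \<ge> 1 \<Longrightarrow> square_integrable_rv M (X k)"
    and "\<And>k. k \<ge> 1 \<Longrightarrow> almost_separably_valued M (X k)"
    and "\<And>k. k \<ge> 1 \<Longrightarrow> hexpectation M (X k) = \<nu> k"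
    and "n \<ge> 1"
  shows "(\<integral>\<^sup>+\<omega>. ennreal ((dist (inductive_mean (\<lambda>k. X k \<omega>) n) \<mu>)\<^sup>2) \<partial>M)
    \<le> ennreal (6 * max_deviation M X \<nu> \<mu> n / real n * (\<Sum>k=1..n. dist (\<nu> k) \<mu>)
        + 1 / (real n)\<^sup>2 * (\<Sum>k=1..n. hvariance M (X k)))"
proof -
  interpret prob_space M by fact
  have meas: "X k \<in> borel_measurable M" if "k \<ge> 1" for k
    using assms(3)[OF that] unfolding square_integrable_rv_def by blast
  \<comment> \<open>Replace each variable by its image under a map of separable range that fixes a set carrying its law.\<close>
  have "\<exists>r. separable_rv borel r \<and> (k \<ge> 1 \<longrightarrow> (AE \<omega> in M. r (X k \<omega>) = X k \<omega>))" for k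
  proof -
    obtain C where C: "countable C" "k \<ge> 1 \<Longrightarrow> AE \<omega> in M. X k \<omega> \<in> closure C"
      using assms(4)[of k] countable_empty unfolding almost_separably_valued_def by metis
    obtain r :: "'a \<Rightarrow> 'a" where r: "separable_rv borel r" "\<forall>x\<in>closure C. r x = x"
      using separable_retraction_exists[OF C(1)] by blast
    have "AE \<omega> in M. r (X k \<omega>) = X k \<omega>" if "k \<ge> 1"
      using C(2)[OF that] by eventually_elim (use r in blast)
    then show ?thesis using r by blast
  qed
  then obtain g where g: "\<And>k. separable_rv borel (g k)"
    and gX: "\<And>k. k \<ge> 1 \<Longrightarrow> AE \<omega> in M. g k (X k \<omega>) = X k \<omega>"
    by metis
  define Y where "Y k \<omega> = g k (X k \<omega>)" for k \<omega>
  have YX: "AE \<omega> in M. Y k \<omega> = X k \<omega>" if "k \<ge> 1" for k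
    using gX[OF that] by (simp add: Y_def)
  have sep: "separable_rv M (Y k)" if "k \<ge> 1" for k
    using separable_rv_compose[OF g meas[OF that]] by (simp add: Y_def[abs_def])
  have [measurable]: "X k \<in> borel_measurable M" "Y k \<in> borel_measurable M" if "k \<ge> 1" for k
    using meas sep[THEN separable_rv_measurable] that by auto
  have eq: "(\<integral>\<omega>. f (Y k \<omega>) \<partial>M) = (\<integral>\<omega>. f (X k \<omega>) \<partial>M)"
    if k: "k \<ge> 1" and f: "f \<in> borel_measurable borel" for k and f :: "'a \<Rightarrow> real"
  proof (rule integral_cong_AE)
    show "(\<lambda>\<omega>. f (Y k \<omega>)) \<in> borel_measurable M" "(\<lambda>\<omega>. f (X k \<omega>)) \<in> borel_measurable M"
      using k f by measurable
    show "AE \<omega> in M. f (Y k \<omega>) = f (X k \<omega>)"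
      using YX[OF k] by eventually_elim simp
  qed
  have eq_sq: "(\<integral>\<omega>. (dist (Y k \<omega>) z)\<^sup>2 \<partial>M) = (\<integral>\<omega>. (dist (X k \<omega>) z)\<^sup>2 \<partial>M)" if "k \<ge> 1" for k z
    by (rule eq[OF that]) measurable
  have eq_dist: "(\<integral>\<omega>. dist (Y k \<omega>) z \<partial>M) = (\<integral>\<omega>. dist (X k \<omega>) z \<partial>M)" if "k \<ge> 1" for k z
    by (rule eq[OF that]) measurable
  have sq: "square_integrable_rv M (Y k)" if k: "k \<ge> 1" for k
  proof -
    have "integrable M (\<lambda>\<omega>. (dist (Y k \<omega>) \<mu>)\<^sup>2)"
    proof (rule integrable_cong_AE_imp)
      show "integrable M (\<lambda>\<omega>. (dist (X k \<omega>) \<mu>)\<^sup>2)"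
        by (rule square_integrable_rvD(2)[OF assms(3)[OF k]])
      show "(\<lambda>\<omega>. (dist (Y k \<omega>) \<mu>)\<^sup>2) \<in> borel_measurable M"
        using k by measurable
      show "AE \<omega> in M. (dist (X k \<omega>) \<mu>)\<^sup>2 = (dist (Y k \<omega>) \<mu>)\<^sup>2"
        using YX[OF k] by eventually_elim simp
    qed
    then show ?thesis
      using sep[OF k, THEN separable_rv_measurable] unfolding square_integrable_rv_def by blast
  qed
  have hexp: "hexpectation M (Y k) = \<nu> k" if "k \<ge> 1" for k
    using assms(5)[OF that] by (simp add: hexpectation_def eq_sq[OF that])
  have hvar: "hvariance M (Y k) = hvariance M (X k)" if "k \<ge> 1" for k
    using assms(5)[OF that] hexp[OF that] by (simp add: hvariance_def eq_sq[OF that])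
  let ?D = "max_deviation M X \<nu> \<mu> n"
  have D: "dist (\<nu> k) \<mu> \<le> ?D" "(\<integral>\<omega>. dist (Y k \<omega>) (\<nu> k) \<partial>M) \<le> ?D" if "k \<in> {1..n}" for k
  proof -
    have "max (dist \<mu> (\<nu> k)) (\<integral>\<omega>. dist (X k \<omega>) (\<nu> k) \<partial>M) \<le> ?D"
      unfolding max_deviation_def using that by (intro Max_ge) auto
    then show "dist (\<nu> k) \<mu> \<le> ?D" "(\<integral>\<omega>. dist (Y k \<omega>) (\<nu> k) \<partial>M) \<le> ?D"
      using that by (simp_all add: dist_commute[of "\<nu> k" \<mu>] eq_dist)
  qed
  let ?S = "\<lambda>\<omega>. inductive_mean (\<lambda>k. Y k \<omega>) n"
  have "(real n)\<^sup>2 * (\<integral>\<omega>. (dist (?S \<omega>) \<mu>)\<^sup>2 \<partial>M)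
      \<le> (\<Sum>k=1..n. hvariance M (Y k)) + 6 * real n * ?D * (\<Sum>k=1..n. dist (\<nu> k) \<mu>)"
  proof (rule expected_sq_dist_inductive_mean[OF sep sq hexp _ \<open>n \<ge> 1\<close> D])
    show "indep_var borel (\<lambda>\<omega>. inductive_mean (\<lambda>k. Y k \<omega>) j) borel (Y (Suc j))" if "j \<ge> 1" for j
      using indep_var_inductive_mean[OF assms(2) g that] by (simp add: Y_def[abs_def])
  qed
  also have "(\<Sum>k=1..n. hvariance M (Y k)) = (\<Sum>k=1..n. hvariance M (X k))"
    by (intro sum.cong) (auto simp: hvar)
  finally have "(\<integral>\<omega>. (dist (?S \<omega>) \<mu>)\<^sup>2 \<partial>M)
      \<le> 6 * ?D / real n * (\<Sum>k=1..n. dist (\<nu> k) \<mu>) + 1 / (real n)\<^sup>2 * (\<Sum>k=1..n. hvariance M (X k))"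
    using \<open>n \<ge> 1\<close> by (simp add: field_simps power2_eq_square)
  moreover have "(\<integral>\<^sup>+\<omega>. ennreal ((dist (inductive_mean (\<lambda>k. X k \<omega>) n) \<mu>)\<^sup>2) \<partial>M)
      = (\<integral>\<^sup>+\<omega>. ennreal ((dist (?S \<omega>) \<mu>)\<^sup>2) \<partial>M)"
  proof (rule nn_integral_cong_AE)
    have "AE \<omega> in M. \<forall>k\<in>{1..n}. Y k \<omega> = X k \<omega>"
      using YX by (intro AE_finite_allI) auto
    then show "AE \<omega> in M. ennreal ((dist (inductive_mean (\<lambda>k. X k \<omega>) n) \<mu>)\<^sup>2) = ennreal ((dist (?S \<omega>) \<mu>)\<^sup>2)"
    proof eventually_elim
      case (elim \<omega>)
      then have "inductive_mean (\<lambda>k. X k \<omega>) n = ?S \<omega>"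
        by (intro inductive_mean_cong) simp
      then show ?case by simp
    qed
  qed
  moreover have "\<dots> = ennreal (\<integral>\<omega>. (dist (?S \<omega>) \<mu>)\<^sup>2 \<partial>M)"
    by (intro nn_integral_eq_integral square_integrable_rvD(2)
        square_integrable_inductive_mean sep sq \<open>n \<ge> 1\<close>) auto
  ultimately show ?thesis
    by (simp add: ennreal_leI)
qed

end
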